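(* Let $\Omega\subset\mathbb R^2$ be a compact convex set and $X:=\Omega\cap\mathbb Z^2$. Let $\mathcal V,\mathcal V'$ be two families of stencils on $X$. Then the union $\mathcal V\cup\mathcal V'$ and the intersection $\mathcal V\cap\mathcal V'$ are also families of stencils on $X$. In addition $$\mathrm{Conv}(\mathcal V)\cap\mathrm{Conv}(\mathcal V')=\mathrm{Conv}(\mathcal V\cap\mathcal V'),\qquad \mathrm{Conv}(\mathcal V)\cup\mathrm{Conv}(\mathcal V')\subseteq\mathrm{Conv}(\mathcal V\cup\mathcal V').$$
   Context: $\|\cdot\|$ is the Euclidean norm. A vector $e=(\alpha,\beta)\in\mathbb Z^2$ is irreducible iff $\gcd(\alpha,\beta)=1$. A basis of $\mathbb Z^2$ is a pair $(f,g)\in(\mathbb Z^2)^2$ with $|\det(f,g)|=1$; it is direct iff $\det(f,g)=1$, acute iff $\langle f,g\rangle\ge 0$. For each irreducible $e\in\mathbb Z^2$ with $\|e\|>1$ there is a unique direct acute basis $(f,g)$ with $e=f+g$; $f,g$ are called the parents of $e$. Unit vectors have no parents. Linear forms: $S_x^e(u):=u(x+e)-2u(x)+u(x-e)$ for $e$ irreducible; for $e$ irreducible with $\|e\|>1$, of parents $f,g$, $T_x^e(u):=u(x+e)+u(x-f)+u(x-g)-3u(x)$ and $P_x^e(u):=u(x+e)-u(x+f)-u(x+g)+u(x)$. The support of a form is the set of points at which $u$ is evaluated with nonzero weight. For $x\in X$ let $\mathcal V_{\max}(x):=\{e\in\mathbb Z^2\text{ irreducible}: x+e\in X\}$. $\mathrm{Cone}(A)$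 is the convex cone generated by $A$, with $\mathrm{Cone}(\emptyset)=\{0\}$. A family of stencils on $X$ is a collection $\mathcal V=(\mathcal V(x))_{x\in X}$ of subsets $\mathcal V(x)\subseteq\mathcal V_{\max}(x)$ such that for all $x\in X$: (Stability) any parent $f\in\mathcal V_{\max}(x)$ of any $e\in\mathcal V(x)$ satisfies $f\in\mathcal V(x)$; (Visibility) $\mathrm{Cone}(\mathcal V(x))=\mathrm{Cone}(\mathcal V_{\max}(x))$. The set of candidates for refinement $\hat{\mathcal V}(x)$ consists of all $e\in\mathcal V_{\max}(x)\setminus\mathcal V(x)$ having two parents, both belonging to $\mathcal V(x)$. $\mathrm{Conv}(\mathcal V)$ is the set of $u:X\to\mathbb R$ such that for all $x\in X$: $S_x^e(u)\ge0$ for all $e\in\mathcal V(x)$ such that $S_x^e$ is supported in $X$; $T_x^e(u)\ge0$ for all $e\in\mathcal V(x)$ with $\|e\|>1$ such that $T_x^e$ is supported in $X$; $P_x^e(u)\ge0$ for all $e\in\hat{\mathcal V}(x)$. Unions, intersections and inclusions of families of stencils are pointwise in $x$ (a family $\mathcal V$ is identified with $\{(x,e): x\in X, e\in\mathcal V(x)\}$). *)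

theory Defs
  imports "HOL-Analysis.Analysis"
begin

type_synonym point = "int \<times> int"

definition emb :: "point \<Rightarrow> real \<times> real" where
  "emb z = (of_int (fst z), of_int (snd z))"

definition lattice_points :: "(real \<times> real) set \<Rightarrow> point set" where
  "lattice_points \<Omega> = {z. emb z \<in> \<Omega>}"


subsection \<open>Irreducible vectors, bases and parents\<close>

definition irreducible_vec :: "point \<Rightarrow> bool" where
  "irreducible_vec e \<longleftrightarrow> gcd (fst e) (snd e) = 1"

definition det2 :: "point \<Rightarrow> point \<Rightarrow> int" where
  "det2 f g = fst f * snd g - snd f * fst g"

definition is_basis :: "point \<Rightarrow> point \<Rightarrow> bool" where
  "is_basis f g \<longleftrightarrow> \<bar>det2 f g\<bar> = 1"

definition is_direct :: "point \<Rightarrow> point \<Rightarrow> bool" where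
  "is_direct f g \<longleftrightarrow> det2 f g = 1"

definition is_acute :: "point \<Rightarrow> point \<Rightarrow> bool" where
  "is_acute f g \<longleftrightarrow> emb f \<bullet> emb g \<ge> 0"

definition direct_acute_decomp :: "point \<Rightarrow> point \<Rightarrow> point \<Rightarrow> bool" where
  "direct_acute_decomp e f g \<longleftrightarrow>
     is_basis f g \<and> is_direct f g \<and> is_acute f g \<and> e = f + g"

definition has_parents :: "point \<Rightarrow> bool" where
  "has_parents e \<longleftrightarrow> irreducible_vec e \<and> norm (emb e) > 1"

(* Only meaningful when has_parents e holds; well-definedness is direct_acute_decomp_ex1 below. *)
definition parents :: "point \<Rightarrow> point \<times> point" where
  "parents e = (THE p. direct_acute_decomp e (fst p) (snd p))"

definition is_parent :: "point \<Rightarrow> point \<Rightarrow> bool" where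
  "is_parent f e \<longleftrightarrow> has_parents e \<and> (f = fst (parents e) \<or> f = snd (parents e))"

lemma inner_emb: "emb f \<bullet> emb g = of_int (fst f * fst g + snd f * snd g)"
  by (simp add: emb_def inner_prod_def)

lemma norm_emb_gt_1: "norm (emb e) > 1 \<longleftrightarrow> fst e * fst e + snd e * snd e > 1"
proof -
  have "norm (emb e) > 1 \<longleftrightarrow> (norm (emb e))\<^sup>2 > 1"
    by (metis norm_ge_zero one_power2 power2_less_imp_less power_strict_mono zero_le_one
        zero_neq_numeral pos2)
  also have "\<dots> \<longleftrightarrow> fst e * fst e + snd e * snd e > 1"
    unfolding power2_norm_eq_inner inner_emb by linarith
  finally show ?thesis .
qed

lemma direct_acute_decomp_exists:
  assumes "has_parents e"
  shows "\<exists>f g. direct_acute_decomp e f g"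
proof -
  obtain a b where e: "e = (a, b)" by (cases e)
  have cop: "coprime a b" and N1: "a * a + b * b > 1"
    using assms by (auto simp: has_parents_def irreducible_vec_def norm_emb_gt_1 e coprime_iff_gcd_eq_1)
  define N where "N = a * a + b * b"
  obtain u v where uv: "u * a + v * b = 1"
    using bezout_int[of a b] cop by (auto simp: coprime_iff_gcd_eq_1)
  define s0 where "s0 = v * a - u * b"
  define k where "k = s0 div N"
  define p where "p = v - k * a"
  define q where "q = - u - k * b"
  define s where "s = p * a + q * b"
  have det: "p * b - q * a = 1" using uv by (simp add: p_def q_def algebra_simps)
  have "s = s0 - k * N" by (simp add: s_def p_def q_def s0_def N_def algebra_simps)
  hence s: "s = s0 mod N" by (simp add: k_def minus_div_mult_eq_mod)
  have sN: "0 \<le> s" "s < N" using N1 by (simp_all add: s N_def)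
  have lag: "(p * p + q * q) * N = s * s + 1"
  proof -
    have "(p * p + q * q) * N = s * s + (p * b - q * a) * (p * b - q * a)"
      by (simp add: s_def N_def algebra_simps)
    thus ?thesis using det by simp
  qed
  have "s \<noteq> 0"
  proof
    assume "s = 0"
    hence "N * (p * p + q * q) = 1" using lag by (simp add: mult.commute)
    hence "N dvd 1" by (metis dvd_triv_left)
    thus False using N1 by (simp add: N_def)
  qed
  hence "s * (N - s) \<ge> 1" using sN by (simp add: int_one_le_iff_zero_less)
  hence "(s - (p * p + q * q)) * N \<ge> 0" using lag by (simp add: algebra_simps)
  hence ac: "s - (p * p + q * q) \<ge> 0" using N1 by (simp add: zero_le_mult_iff N_def)
  have "direct_acute_decomp e (p, q) (a - p, b - q)"
    using det ac
    by (simp add: direct_acute_decomp_def is_basis_def is_direct_def is_acute_def det2_def inner_emb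
        e s_def algebra_simps flip: of_int_mult of_int_add of_int_diff)
  thus ?thesis by blast
qed

lemma direct_acute_decomp_inner_bounds:
  assumes "direct_acute_decomp e f g"
  shows "0 < fst f * fst e + snd f * snd e"
    and "fst f * fst e + snd f * snd e < fst e * fst e + snd e * snd e"
proof -
  obtain p q r t where fg: "f = (p, q)" "g = (r, t)" by (cases f, cases g)
  have ac: "p * r + q * t \<ge> 0" and det: "p * t - q * r = 1" and e: "e = (p + r, q + t)"
    using assms
    by (auto simp: direct_acute_decomp_def is_direct_def is_acute_def det2_def inner_emb fg
        simp flip: of_int_mult of_int_add)
  have "p * p + q * q > 0" "r * r + t * t > 0"
    using det by (auto simp: sum_squares_gt_zero_iff)
  thus "0 < fst f * fst e + snd f * snd e"
    and "fst f * fst e + snd f * snd e < fst e * fst e + snd e * snd e"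
    using ac by (simp_all add: fg e algebra_simps)
qed

lemma direct_acute_decomp_unique:
  assumes 1: "direct_acute_decomp e f g" and 2: "direct_acute_decomp e f' g'"
  shows "f = f' \<and> g = g'"
proof -
  obtain a b p q p' q' where v: "e = (a, b)" "f = (p, q)" "f' = (p', q')"
    by (cases e, cases f, cases f')
  have g: "g = e - f" using 1 unfolding direct_acute_decomp_def by simp
  have g': "g' = e - f'" using 2 unfolding direct_acute_decomp_def by simp
  define N where "N = a * a + b * b"
  have d: "p * b - q * a = 1" and d': "p' * b - q' * a = 1"
    using 1 2 g g' by (auto simp: direct_acute_decomp_def is_direct_def det2_def v algebra_simps)
  define s where "s = p * a + q * b"
  define s' where "s' = p' * a + q' * b"
  have b: "0 < s" "s < N" "0 < s'" "s' < N"
    using direct_acute_decomp_inner_bounds[OF 1] direct_acute_decomp_inner_bounds[OF 2]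
    by (auto simp: s_def s'_def N_def v)
  define k where "k = p * q' - q * p'"
  have k1: "p' = p + k * a"
  proof -
    have "p' - p = p' * (p * b - q * a) - p * (p' * b - q' * a)" by (simp only: d d')
    thus ?thesis by (simp add: k_def algebra_simps)
  qed
  have k2: "q' = q + k * b"
  proof -
    have "q' - q = q' * (p * b - q * a) - q * (p' * b - q' * a)" by (simp only: d d')
    thus ?thesis by (simp add: k_def algebra_simps)
  qed
  have "s' - s = k * N" by (simp add: s_def s'_def N_def k1 k2 algebra_simps)
  hence kN: "\<bar>k * N\<bar> < N" using b by linarith
  have "k = 0"
  proof (rule ccontr)
    assume "k \<noteq> 0"
    hence "1 * N \<le> \<bar>k\<bar> * N" using b by (intro mult_right_mono) auto
    thus False using kN b by (simp add: abs_mult)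
  qed
  thus ?thesis using k1 k2 g g' by (simp add: v)
qed

lemma direct_acute_decomp_ex1:
  assumes "has_parents e"
  shows "\<exists>!p. direct_acute_decomp e (fst p) (snd p)"
  using direct_acute_decomp_exists[OF assms] direct_acute_decomp_unique
  by (metis fst_conv snd_conv prod_eq_iff)

lemma parents_decomp:
  "has_parents e \<Longrightarrow> direct_acute_decomp e (fst (parents e)) (snd (parents e))"
  unfolding parents_def by (rule theI'[OF direct_acute_decomp_ex1])

lemma parents_eqI: "direct_acute_decomp e f g \<Longrightarrow> parents e = (f, g)"
  unfolding parents_def
  by (rule the_equality) (auto dest: direct_acute_decomp_unique)


subsection \<open>Linear forms and their supports\<close>

definition S_form :: "point \<Rightarrow> point \<Rightarrow> (point \<Rightarrow> real) \<Rightarrow> real" where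
  "S_form x e u = u (x + e) - 2 * u x + u (x - e)"

definition T_form :: "point \<Rightarrow> point \<Rightarrow> (point \<Rightarrow> real) \<Rightarrow> real" where
  "T_form x e u =
     (case parents e of (f, g) \<Rightarrow> u (x + e) + u (x - f) + u (x - g) - 3 * u x)"

definition P_form :: "point \<Rightarrow> point \<Rightarrow> (point \<Rightarrow> real) \<Rightarrow> real" where
  "P_form x e u =
     (case parents e of (f, g) \<Rightarrow> u (x + e) - u (x + f) - u (x + g) + u x)"

(* The weight of a form at y is its value at the indicator function of {y}. *)
definition form_support :: "((point \<Rightarrow> real) \<Rightarrow> real) \<Rightarrow> point set" where
  "form_support L = {y. L (\<lambda>z. if z = y then 1 else 0) \<noteq> 0}"

lemma form_support_S:
  assumes "irreducible_vec e"
  shows "form_support (S_form x e) = {x + e, x, x - e}"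
  using assms
  by (cases e; cases x) (auto simp: form_support_def S_form_def irreducible_vec_def split: if_splits)

lemma form_support_T:
  assumes "has_parents e"
  shows "form_support (T_form x e) = {x + e, x, x - fst (parents e), x - snd (parents e)}"
proof -
  obtain p q r t where fg: "parents e = ((p, q), (r, t))" by (metis prod.exhaust)
  obtain a b where x: "x = (a, b)" by (cases x)
  have det: "p * t - q * r = 1" and e: "e = (p + r, q + t)"
    using parents_decomp[OF assms]
    by (simp_all add: fg direct_acute_decomp_def is_direct_def det2_def)
  have 1: "\<not> (p + r = 0 \<and> q + t = 0)"
  proof
    assume "p + r = 0 \<and> q + t = 0"
    hence "r = - p" "t = - q" by auto
    thus False using det by simp
  qed
  have 2: "\<not> (p + r = - p \<and> q + t = - q)"
  proof
    assume "p + r = - p \<and> q + t = - q"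
    hence "r = - 2 * p" "t = - 2 * q" by auto
    thus False using det by simp
  qed
  have 3: "\<not> (p + r = - r \<and> q + t = - t)"
  proof
    assume "p + r = - r \<and> q + t = - t"
    hence "p = - 2 * r" "q = - 2 * t" by auto
    thus False using det by simp
  qed
  have 4: "\<not> (p = 0 \<and> q = 0)" "\<not> (r = 0 \<and> t = 0)" "\<not> (p = r \<and> q = t)"
    using det by auto
  have ne: "x + e \<noteq> x" "x - (p, q) \<noteq> x" "x - (r, t) \<noteq> x" "x + e \<noteq> x - (p, q)"
    "x + e \<noteq> x - (r, t)" "x - (p, q) \<noteq> x - (r, t)"
    using 1 2 3 4 by (auto simp: x e)
  show ?thesis
    using ne by (auto simp: form_support_def T_form_def fg split: if_splits)
qed


subsection \<open>Families of stencils\<close>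

definition V_max :: "point set \<Rightarrow> point \<Rightarrow> point set" where
  "V_max X x = {e. irreducible_vec e \<and> x + e \<in> X}"

definition Cone :: "point set \<Rightarrow> (real \<times> real) set" where
  "Cone A = convex_cone hull (emb ` A)"

(* A family (V x), x in X, is a total function whose values outside X are irrelevant. *)
definition stencil_family :: "point set \<Rightarrow> (point \<Rightarrow> point set) \<Rightarrow> bool" where
  "stencil_family X V \<longleftrightarrow> (\<forall>x\<in>X.
     V x \<subseteq> V_max X x \<and>
     (\<forall>e\<in>V x. \<forall>f\<in>V_max X x. is_parent f e \<longrightarrow> f \<in> V x) \<and>
     Cone (V x) = Cone (V_max X x))"

definition candidates :: "point set \<Rightarrow> (point \<Rightarrow> point set) \<Rightarrow> point \<Rightarrow> point set" where
  "candidates X V x =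
     {e \<in> V_max X x - V x. has_parents e \<and> fst (parents e) \<in> V x \<and> snd (parents e) \<in> V x}"

(* Functions X \<Rightarrow> real are the functions in extensional X. *)
definition Conv :: "point set \<Rightarrow> (point \<Rightarrow> point set) \<Rightarrow> (point \<Rightarrow> real) set" where
  "Conv X V = {u \<in> extensional X. \<forall>x\<in>X.
     (\<forall>e\<in>V x. form_support (S_form x e) \<subseteq> X \<longrightarrow> S_form x e u \<ge> 0) \<and>
     (\<forall>e\<in>V x. norm (emb e) > 1 \<longrightarrow> form_support (T_form x e) \<subseteq> X \<longrightarrow> T_form x e u \<ge> 0) \<and>
     (\<forall>e\<in>candidates X V x. P_form x e u \<ge> 0)}"

end

theory Submission
  imports Defs
begin

text \<open>Everything rests on one fact (\<open>missing_vector_parents\<close>): if an irreducible vector \<open>e\<close> is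
  admissible at \<open>x\<close>, that is \<open>x + e \<in> X\<close>, but is missing from a stencil \<open>V x\<close>, then \<open>e\<close> has parents and
  both are admissible. To see this, visibility gives two vectors of the stencil with \<open>e\<close> strictly between them.
  Stability and the convexity of \<open>X\<close> allow this pair to be refined by inserting parents until it is a direct
  acute basis \<open>(f, g)\<close> (\<open>enclosing_unimodular_pair\<close>, \<open>enclosing_acute_pair\<close>). The parents of \<open>e\<close> then
  lie in the triangle spanned by \<open>0\<close>, \<open>f\<close>, \<open>e\<close> and in that spanned by \<open>0\<close>, \<open>e\<close>, \<open>g\<close>.

  Stability of unions and intersections, and visibility of unions, are immediate. The intersection is visible
  because a vector missing from it is the sum of its two shorter admissible parents, so that induction on the
  norm puts it into the cone.

  Both assertions on \<open>Conv\<close> follow from monotonicity (\<open>Conv_mono\<close>): \<open>Conv X W \<subseteq> Conv X V\<close> for families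
  of stencils \<open>W \<subseteq> V\<close>. The remaining inclusion \<open>Conv X V \<inter> Conv X V' \<subseteq> Conv X (V \<inter> V')\<close>, with the intersection
  of the families taken pointwise, holds because a candidate of the intersection is a candidate of \<open>V\<close> or of \<open>V'\<close>.
  For monotonicity, induction on the norm of \<open>e\<close> shows that every \<open>u \<in> Conv X W\<close> has nonnegative second
  differences \<open>S\<^sup>e\<close> wherever they fit into \<open>X\<close>, and nonnegative \<open>P\<^sup>e\<close> at every admissible \<open>e\<close> missing from
  \<open>W\<close> (\<open>Conv_forms_nonneg\<close>). With \<open>p\<close>, \<open>q\<close> the parents of \<open>e\<close>, the induction uses the identities
  \<open>S\<^sup>e = P\<^sup>e + P\<^sup>-\<^sup>e + S\<^sup>p + S\<^sup>q\<close> and, when \<open>p\<close> is itself a parent of \<open>q\<close>,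
  \<open>P\<^sup>e = P\<^sup>q + S\<^sup>p\<close> with the last term taken at \<open>x + q\<close>. Finally \<open>T\<^sup>e = P\<^sup>e + S\<^sup>p + S\<^sup>q\<close>.\<close>

section \<open>Integer determinants and inner products\<close>

definition ip :: "point \<Rightarrow> point \<Rightarrow> int" where
  "ip f g = fst f * fst g + snd f * snd g"

text \<open>This identity drives the arithmetic: for a basis of the lattice it reads
  \<open>\<langle>f, g\<rangle>\<^sup>2 + 1 = |f|\<^sup>2 |g|\<^sup>2\<close>, so that, except for two unit vectors, \<open>|\<langle>f, g\<rangle>|\<close> cannot be smaller
  than both squared norms.\<close>

lemma lagrange_identity: "(ip f g)^2 + (det2 f g)^2 = ip f f * ip g g"
  by (cases f; cases g) (simp add: ip_def det2_def power2_eq_square algebra_simps)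

lemma ip_self_nonneg: "0 \<le> ip f f"
  by (simp add: ip_def)

lemma ip_self_pos: "det2 f g \<noteq> 0 \<Longrightarrow> 0 < ip f f" "det2 f g \<noteq> 0 \<Longrightarrow> 0 < ip g g"
  by (auto simp: ip_def det2_def sum_squares_gt_zero_iff)

lemma ip_bilinear:
  "ip (f + g) h = ip f h + ip g h" "ip h (f + g) = ip h f + ip h g"
  "ip (f - g) h = ip f h - ip g h" "ip h (f - g) = ip h f - ip h g"
  "ip (- f) h = - ip f h" "ip h (- f) = - ip h f"
  by (auto simp: ip_def algebra_simps)

lemma det2_bilinear:
  "det2 (f + g) h = det2 f h + det2 g h" "det2 h (f + g) = det2 h f + det2 h g"
  "det2 (f - g) h = det2 f h - det2 g h" "det2 h (f - g) = det2 h f - det2 h g"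
  "det2 (- f) h = - det2 f h" "det2 h (- f) = - det2 h f"
  by (auto simp: det2_def algebra_simps)

lemma det2_self [simp]: "det2 f f = 0"
  by (simp add: det2_def)

lemma det2_swap: "det2 g f = - det2 f g"
  by (simp add: det2_def algebra_simps)

lemma ip_commute: "ip f g = ip g f"
  by (simp add: ip_def algebra_simps)

text \<open>With \<open>det2 f g > 0\<close>, the signs of \<open>det2 h g\<close> and \<open>det2 f h\<close> say where \<open>h\<close> lies with respect to
  the cone of \<open>f\<close> and \<open>g\<close>, and their values are its coordinates scaled by \<open>det2 f g\<close>. All geometric
  positions below are expressed in this way.\<close>

lemma cramer_rule:
  "det2 f g * fst h = det2 h g * fst f + det2 f h * fst g"
  "det2 f g * snd h = det2 h g * snd f + det2 f h * snd g"
  by (auto simp: det2_def algebra_simps)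

lemma direct_acute_decomp_iff:
  "direct_acute_decomp e f g \<longleftrightarrow> det2 f g = 1 \<and> 0 \<le> ip f g \<and> e = f + g"
  by (auto simp: direct_acute_decomp_def is_basis_def is_direct_def is_acute_def inner_emb ip_def
      simp flip: of_int_mult of_int_add)

lemma has_parents_iff: "has_parents e \<longleftrightarrow> irreducible_vec e \<and> 1 < ip e e"
  by (simp add: has_parents_def norm_emb_gt_1 ip_def)

lemma irreducible_if_det1:
  assumes "\<bar>det2 f g\<bar> = 1"
  shows "irreducible_vec f" "irreducible_vec g"
proof -
  have "gcd (fst f) (snd f) dvd det2 f g" "gcd (fst g) (snd g) dvd det2 f g"
    by (auto simp: det2_def)
  then have "\<bar>gcd (fst f) (snd f)\<bar> = 1" "\<bar>gcd (fst g) (snd g)\<bar> = 1"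
    using assms by (metis dvd_abs_iff zdvd1_eq)+
  then show "irreducible_vec f" "irreducible_vec g" by (simp_all add: irreducible_vec_def)
qed

lemma irreducible_uminus [simp]: "irreducible_vec (- e) = irreducible_vec e"
  by (simp add: irreducible_vec_def)

lemma irreducible_parallel:
  assumes "irreducible_vec e" "irreducible_vec f" "det2 e f = 0"
  shows "e = f \<or> e = - f"
proof -
  obtain a b c d where v: "e = (a, b)" "f = (c, d)" by (cases e; cases f)
  have eq: "a * d = b * c" using assms by (simp add: det2_def v)
  have cop: "coprime a b" "coprime c d"
    using assms by (auto simp: irreducible_vec_def v coprime_iff_gcd_eq_1)
  obtain s t where st: "s * c + t * d = 1"
    using bezout_int[of c d] cop by (auto simp: coprime_iff_gcd_eq_1)
  define k where "k = s * a + t * b"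
  have a: "a = k * c"
  proof -
    have "a = a * (s * c + t * d)" using st by simp
    also have "\<dots> = s * a * c + t * (a * d)" by (simp add: algebra_simps)
    finally show ?thesis by (simp add: eq k_def algebra_simps)
  qed
  have b: "b = k * d"
  proof -
    have "b = b * (s * c + t * d)" using st by simp
    also have "\<dots> = t * b * d + s * (b * c)" by (simp add: algebra_simps)
    finally show ?thesis by (simp add: eq[symmetric] k_def algebra_simps)
  qed
  have "k dvd 1" using cop(1) a b by (metis coprime_common_divisor dvd_triv_left)
  then have "k = 1 \<or> k = - 1" by auto
  then show ?thesis using a b by (auto simp: v)
qed

lemma decomp_props:
  assumes "direct_acute_decomp e f g"
  shows "has_parents e" "parents e = (f, g)" "is_parent f e" "is_parent g e"
    "irreducible_vec f" "irreducible_vec g" "ip f f < ip e e" "ip g g < ip e e"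
    "det2 f e = 1" "det2 e g = 1"
proof -
  have d: "det2 f g = 1" and a: "0 \<le> ip f g" and e: "e = f + g"
    using assms by (auto simp: direct_acute_decomp_iff)
  have p: "0 < ip f f" "0 < ip g g" using ip_self_pos[of f g] d by auto
  have n: "ip e e = ip f f + ip g g + 2 * ip f g"
    by (simp add: e ip_bilinear ip_commute[of g f])
  show "det2 f e = 1" "det2 e g = 1" using d by (auto simp: e det2_bilinear)
  have "irreducible_vec e" using irreducible_if_det1[of f e] \<open>det2 f e = 1\<close> by simp
  then show h: "has_parents e" using p n a by (simp add: has_parents_iff)
  show pe: "parents e = (f, g)" by (rule parents_eqI[OF assms])
  show "is_parent f e" "is_parent g e" using h pe by (auto simp: is_parent_def)
  show "irreducible_vec f" "irreducible_vec g" using irreducible_if_det1[of f g] d by auto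
  show "ip f f < ip e e" "ip g g < ip e e" using p n a by auto
qed

lemma decomp_uminus: "direct_acute_decomp e f g \<Longrightarrow> direct_acute_decomp (- e) (- f) (- g)"
  by (auto simp: direct_acute_decomp_iff det2_bilinear ip_bilinear)

section \<open>Lengths in acute bases, and where parents lie\<close>

text \<open>By the Cramer rule \<open>h\<close> has integer coordinates at least 1 on \<open>p\<close> and \<open>q\<close>, and in the
  expansion of \<open>|h|\<^sup>2\<close> the mixed term is nonnegative.\<close>

lemma inside_acute_cone_longer:
  assumes "det2 p q = 1" "0 \<le> ip p q" "0 < det2 p h" "0 < det2 h q"
  shows "ip p p < ip h h" "ip q q < ip h h"
proof -
  define s t where "s = det2 h q" and "t = det2 p h"
  have st: "1 \<le> s" "1 \<le> t" using assms by (auto simp: s_def t_def)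
  have h: "fst h = s * fst p + t * fst q" "snd h = s * snd p + t * snd q"
    using cramer_rule[of p q h] assms(1) by (auto simp: s_def t_def)
  have n: "ip h h = s^2 * ip p p + t^2 * ip q q + 2 * (s * t) * ip p q"
    by (simp add: ip_def h power2_eq_square algebra_simps)
  have p: "0 < ip p p" "0 < ip q q" using ip_self_pos[of p q] assms(1) by auto
  have "1 \<le> s^2" "1 \<le> t^2" using st by (simp_all add: one_le_power)
  then have "1 * ip p p \<le> s^2 * ip p p" "1 * ip q q \<le> t^2 * ip q q"
    using p by (auto intro!: mult_right_mono)
  moreover have "0 \<le> 2 * (s * t) * ip p q" using st assms(2) by simp
  ultimately show "ip p p < ip h h" "ip q q < ip h h" using n p by linarith+
qed

text \<open>A lattice basis whose inner product were smaller in absolute value than both squared norms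
  would satisfy \<open>\<langle>p, q\<rangle>\<^sup>2 \<le> (|p|\<^sup>2 - 1) (|q|\<^sup>2 - 1)\<close>, and the Lagrange identity would bound
  \<open>|p|\<^sup>2 + |q|\<^sup>2\<close> by 2. So every basis other than a pair of unit vectors can be shortened by adding the
  shorter vector to the longer one or subtracting it.\<close>

lemma basis_reduction:
  assumes d: "\<bar>det2 p q\<bar> = 1" and le: "ip p p \<le> ip q q" and q: "1 < ip q q"
  shows "ip p p \<le> \<bar>ip p q\<bar>"
proof (rule ccontr)
  assume c: "\<not> ?thesis"
  define P Q where "P = ip p p" and "Q = ip q q"
  have "(ip p q)^2 = \<bar>ip p q\<bar> * \<bar>ip p q\<bar>" by (simp add: power2_eq_square)
  also have "\<dots> \<le> (P - 1) * (Q - 1)"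
    using c le by (intro mult_mono) (auto simp: P_def Q_def)
  finally have "P + Q \<le> 2 + (P * Q - 1 - (ip p q)^2)" by (simp add: algebra_simps)
  moreover have "(det2 p q)^2 = 1" using d by (metis one_power2 power2_abs)
  then have "P * Q - 1 - (ip p q)^2 = 0" using lagrange_identity[of p q] by (simp add: P_def Q_def)
  moreover have "0 < P" using ip_self_pos[of p q] d unfolding P_def by auto
  ultimately show False using q by (simp add: Q_def)
qed

text \<open>The longer of the two vectors, say \<open>g\<close>, splits as \<open>(f + g) + (- f)\<close>, and the inequality of the
  previous lemma says exactly that this basis is acute.\<close>

lemma obtuse_sum_is_parent:
  assumes d: "det2 f g = 1" and o: "ip f g < 0"
  shows "is_parent (f + g) f \<or> is_parent (f + g) g"
proof -
  have p: "0 < ip f f" "0 < ip g g" using ip_self_pos[of f g] d by auto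
  have "\<not> (ip f f \<le> 1 \<and> ip g g \<le> 1)"
  proof
    assume "ip f f \<le> 1 \<and> ip g g \<le> 1"
    then have "ip f f = 1" "ip g g = 1" using p by auto
    then have "(ip f g)^2 = 0" using lagrange_identity[of f g] d by simp
    then show False using o by simp
  qed
  then consider "ip g g \<le> ip f f" "1 < ip f f" | "ip f f \<le> ip g g" "1 < ip g g" by linarith
  then show ?thesis
  proof cases
    case 1
    then have "ip g g \<le> \<bar>ip g f\<bar>" using basis_reduction[of g f] d by (simp add: det2_swap[of g f])
    then have "direct_acute_decomp f (- g) (f + g)"
      using d o by (auto simp: direct_acute_decomp_iff det2_bilinear ip_bilinear det2_swap[of g f]
          ip_commute[of g f])
    then show ?thesis using decomp_props(4) by blast
  next
    case 2
    then have "ip f f \<le> \<bar>ip f g\<bar>" using basis_reduction[of f g] d by simp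
    then have "direct_acute_decomp g (f + g) (- f)"
      using d o by (auto simp: direct_acute_decomp_iff det2_bilinear ip_bilinear det2_swap[of g f]
          ip_commute[of g f])
    then show ?thesis using decomp_props(3) by blast
  qed
qed

text \<open>Write \<open>m = det2 f p\<close> and \<open>D = det2 f g\<close>, so that \<open>f = D p - m g\<close>. If \<open>m < 0\<close>, then \<open>f\<close> lies
  inside the acute cone of \<open>p\<close> and \<open>g\<close>; if \<open>m > D\<close>, then \<open>- f\<close> lies inside that of \<open>g\<close> and \<open>q\<close>. In
  both cases \<open>f\<close> would be longer than \<open>g\<close>. The values \<open>m = 0\<close> and \<open>m = D\<close> would make \<open>D\<close> a common
  divisor of the entries of \<open>f\<close>.\<close>

lemma longer_left_parent_inside:
  assumes irr: "irreducible_vec f" and D: "2 \<le> det2 f g" and le: "ip f f \<le> ip g g"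
    and dec: "direct_acute_decomp g p q"
  shows "0 < det2 f p \<and> det2 f p < det2 f g"
proof -
  define m where "m = det2 f p"
  note pq = decomp_props[OF dec]
  have g: "g = p + q" and d: "det2 p q = 1" and a: "0 \<le> ip p q"
    using dec by (auto simp: direct_acute_decomp_iff)
  have f: "fst f = det2 f g * fst p - m * fst g" "snd f = det2 f g * snd p - m * snd g"
    using cramer_rule[of p g f] pq(9) by (auto simp: m_def det2_swap[of p f])
  have nd: "\<not> det2 f g dvd m"
  proof
    assume "det2 f g dvd m"
    then have "det2 f g dvd fst f" "det2 f g dvd snd f" unfolding f(1,2)
      by (metis dvd_diff dvd_mult2 dvd_triv_left f(1), metis dvd_diff dvd_mult2 dvd_triv_left f(2))
    then have "det2 f g dvd 1" using irr by (metis gcd_greatest irreducible_vec_def)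
    then show False using D by simp
  qed
  have "\<not> m < 0"
  proof
    assume "m < 0"
    then have "0 < det2 p f" by (simp add: m_def det2_swap[of p f])
    moreover have "0 \<le> ip p g" using a by (simp add: g ip_bilinear ip_self_nonneg)
    ultimately have "ip g g < ip f f"
      using inside_acute_cone_longer(2)[of p g f] pq(9) D by simp
    then show False using le by simp
  qed
  moreover have "\<not> det2 f g < m"
  proof
    assume m: "det2 f g < m"
    have "0 < det2 g (- f)" using D by (simp add: det2_bilinear det2_swap[of g f])
    moreover have "0 < det2 (- f) q" using m by (simp add: g m_def det2_bilinear)
    moreover have "0 \<le> ip g q" using a by (simp add: g ip_bilinear ip_self_nonneg)
    ultimately have "ip g g < ip (- f) (- f)"
      using inside_acute_cone_longer(1)[of g q "- f"] pq(10) by simp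
    then show False using le by (simp add: ip_bilinear)
  qed
  moreover have "m \<noteq> 0" "m \<noteq> det2 f g" using nd by auto
  ultimately show ?thesis by (auto simp: m_def)
qed

text \<open>The previous lemma seen in the mirror that exchanges the two coordinates; the mirror reverses
  orientation, so \<open>f\<close> and \<open>g\<close>, as well as the two parents, change places.\<close>

lemma longer_right_parent_inside:
  assumes irr: "irreducible_vec g" and D: "2 \<le> det2 f g" and le: "ip g g \<le> ip f f"
    and dec: "direct_acute_decomp f p q"
  shows "0 < det2 q g \<and> det2 q g < det2 f g"
proof -
  have "direct_acute_decomp (prod.swap f) (prod.swap q) (prod.swap p)"
    using dec by (auto simp: direct_acute_decomp_iff det2_def ip_def prod_eq_iff algebra_simps)
  moreover have "irreducible_vec (prod.swap g)"
    using irr by (simp add: irreducible_vec_def gcd.commute)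
  moreover have "det2 (prod.swap u) (prod.swap v) = det2 v u" for u v
    by (simp add: det2_def algebra_simps)
  moreover have "ip (prod.swap u) (prod.swap v) = ip u v" for u v
    by (simp add: ip_def algebra_simps)
  ultimately show ?thesis
    using longer_left_parent_inside[of "prod.swap g" "prod.swap f" "prod.swap q" "prod.swap p"]
      D le by simp
qed

section \<open>Lattice triangles in a convex set\<close>

text \<open>Convexity in the form that lattice arguments consume: \<open>X\<close> contains every lattice point \<open>x + h\<close> of a
  nondegenerate triangle with vertices \<open>x\<close>, \<open>x + f\<close>, \<open>x + g\<close> in \<open>X\<close>. The three inequalities are the
  nonnegativity of the barycentric coordinates of \<open>h\<close>.\<close>

definition triangle_closed :: "point set \<Rightarrow> bool" where
  "triangle_closed X \<longleftrightarrow> (\<forall>x\<in>X. \<forall>f g h. x + f \<in> X \<longrightarrow> x + g \<in> X \<longrightarrow> 0 < det2 f g \<longrightarrow>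
     0 \<le> det2 h g \<longrightarrow> 0 \<le> det2 f h \<longrightarrow> det2 h g + det2 f h \<le> det2 f g \<longrightarrow> x + h \<in> X)"

lemma triangle_closedD:
  "triangle_closed X \<Longrightarrow> x \<in> X \<Longrightarrow> x + f \<in> X \<Longrightarrow> x + g \<in> X \<Longrightarrow> 0 < det2 f g \<Longrightarrow>
   0 \<le> det2 h g \<Longrightarrow> 0 \<le> det2 f h \<Longrightarrow> det2 h g + det2 f h \<le> det2 f g \<Longrightarrow> x + h \<in> X"
  unfolding triangle_closed_def by blast

lemma triangle_closed_lattice_points:
  assumes "convex \<Omega>"
  shows "triangle_closed (lattice_points \<Omega>)"
  unfolding triangle_closed_def
proof (intro ballI allI impI)
  fix x f g h
  assume X: "x \<in> lattice_points \<Omega>" "x + f \<in> lattice_points \<Omega>" "x + g \<in> lattice_points \<Omega>"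
    and D: "0 < det2 f g" and hg: "0 \<le> det2 h g" and fh: "0 \<le> det2 f h"
    and sum: "det2 h g + det2 f h \<le> det2 f g"
  define d s t :: real where "d = of_int (det2 f g)" and "s = of_int (det2 h g)"
    and "t = of_int (det2 f h)"
  have pos: "0 < d" "0 \<le> s" "0 \<le> t" "s + t \<le> d"
    using D hg fh sum by (auto simp: d_def s_def t_def simp flip: of_int_add)
  have cr: "d * of_int (fst h) = s * of_int (fst f) + t * of_int (fst g)"
    "d * of_int (snd h) = s * of_int (snd f) + t * of_int (snd g)"
    using cramer_rule[of f g h] unfolding d_def s_def t_def
    by (simp_all flip: of_int_mult of_int_add)
  have hh: "of_int (fst h) = (s / d) * of_int (fst f) + (t / d) * of_int (fst g)"
    "of_int (snd h) = (s / d) * of_int (snd f) + (t / d) * of_int (snd g)"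
    using cr pos(1) by (simp_all add: field_simps)
  have "((d - s - t) / d) *\<^sub>R emb x + (s / d) *\<^sub>R emb (x + f) + (t / d) *\<^sub>R emb (x + g)
      \<in> convex hull {emb x, emb (x + f), emb (x + g)}"
    unfolding convex_hull_3 mem_Collect_eq using pos
    by (intro exI[of _ "(d - s - t) / d"] exI[of _ "s / d"] exI[of _ "t / d"])
       (simp add: field_simps)
  also have "\<dots> \<subseteq> \<Omega>"
    using X assms by (intro hull_minimal) (auto simp: lattice_points_def)
  finally have "((d - s - t) / d) *\<^sub>R emb x + (s / d) *\<^sub>R emb (x + f) + (t / d) *\<^sub>R emb (x + g)
      \<in> \<Omega>" .
  moreover have "((d - s - t) / d) *\<^sub>R emb x + (s / d) *\<^sub>R emb (x + f) + (t / d) *\<^sub>R emb (x + g)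
      = emb (x + h)"
    using pos(1) by (simp add: emb_def hh field_simps)
  ultimately show "x + h \<in> lattice_points \<Omega>" by (simp add: lattice_points_def)
qed


section \<open>Members of planar cones\<close>

definition det2_real :: "real \<times> real \<Rightarrow> real \<times> real \<Rightarrow> real" where
  "det2_real f g = fst f * snd g - snd f * fst g"

lemma det2_real_linear:
  "det2_real (f + g) h = det2_real f h + det2_real g h"
  "det2_real h (f + g) = det2_real h f + det2_real h g"
  "det2_real (c *\<^sub>R f) h = c * det2_real f h" "det2_real h (c *\<^sub>R f) = c * det2_real h f"
  "det2_real 0 h = 0" "det2_real h 0 = 0" "det2_real f f = 0"
  by (auto simp: det2_real_def algebra_simps)

lemma det2_real_emb: "det2_real (emb f) (emb g) = of_int (det2 f g)"
  by (simp add: det2_real_def det2_def emb_def)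

text \<open>For a fixed second argument the inequality cuts out a half-plane through the origin, hence
  passes from \<open>A\<close> to its hull; then the same argument applies to the other argument.\<close>

lemma det2_real_hull_nonpos:
  assumes "\<And>f g. f \<in> A \<Longrightarrow> g \<in> B \<Longrightarrow> det2_real f g \<le> 0"
    and "F \<in> convex_cone hull A" "G \<in> convex_cone hull B"
  shows "det2_real F G \<le> 0"
proof -
  have 1: "convex_cone {x. det2_real x y \<le> 0}" for y
    by (auto simp: convex_cone_iff det2_real_linear mult_nonneg_nonpos)
  have 2: "convex_cone {x. det2_real y x \<le> 0}" for y
    by (auto simp: convex_cone_iff det2_real_linear mult_nonneg_nonpos)
  have "F \<in> {x. det2_real x g \<le> 0}" if "g \<in> B" for g
    using assms(1)[OF _ that] assms(2) hull_minimal[of A _ convex_cone, OF _ 1, of g] by blast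
  then show ?thesis
    using assms(3) hull_minimal[of B _ convex_cone, OF _ 2, of F] by blast
qed

lemma linear_pos_on_cone_hull:
  fixes l :: "'a::real_vector \<Rightarrow> real"
  assumes "linear l" "\<And>f. f \<in> A \<Longrightarrow> 0 < l f" "F \<in> convex_cone hull A"
  shows "F = 0 \<or> 0 < l F"
proof -
  have "convex_cone {x. x = 0 \<or> 0 < l x}"
    using assms(1)
    by (auto simp: convex_cone_iff linear_add linear_cmul linear_0 less_eq_real_def)
  then show ?thesis
    using assms(2,3) hull_minimal[of A "{x. x = 0 \<or> 0 < l x}" convex_cone] by blast
qed

text \<open>A planar form of the conic Caratheodory theorem. Each element of \<open>A\<close>
  is strictly to the right of \<open>e\<close> (set \<open>R\<close>), strictly to the left (set \<open>L\<close>), or equal to \<open>- e\<close>, so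
  \<open>(1 + c) e = F + G\<close> with \<open>c \<ge> 0\<close> and \<open>F\<close>, \<open>G\<close> in the cones of \<open>R\<close> and \<open>L\<close>. If no pair in
  \<open>R \<times> L\<close> were positively oriented, then \<open>(1 + c) det (F, e) = det (F, G) \<le> 0\<close>, which forces \<open>F = 0\<close>;
  likewise \<open>G = 0\<close>, and \<open>e\<close> would vanish.\<close>

lemma cone_member_strictly_between:
  assumes irr: "irreducible_vec e" "\<And>f. f \<in> A \<Longrightarrow> irreducible_vec f"
    and e: "emb e \<in> Cone A" "e \<notin> A"
  shows "\<exists>f\<in>A. \<exists>g\<in>A. 0 < det2 f e \<and> 0 < det2 e g \<and> 0 < det2 f g"
proof (rule ccontr)
  assume no: "\<not> ?thesis"
  define R L where "R = {f \<in> A. 0 < det2 f e}" and "L = {g \<in> A. 0 < det2 e g}"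
  have "A \<subseteq> (R \<union> L) \<union> {- e}"
  proof
    fix f assume f: "f \<in> A"
    then have "det2 e f = 0 \<longrightarrow> f = - e"
      using irreducible_parallel[of e f] irr e(2) by auto
    then show "f \<in> (R \<union> L) \<union> {- e}"
      using f by (auto simp: R_def L_def det2_swap[of f e])
  qed
  then have "emb ` A \<subseteq> (emb ` R \<union> emb ` L) \<union> {emb (- e)}" by auto
  then have "emb e \<in> convex_cone hull ((emb ` R \<union> emb ` L) \<union> {emb (- e)})"
    using e(1) hull_mono unfolding Cone_def by blast
  then obtain F G H where F: "F \<in> convex_cone hull (emb ` R)" and G: "G \<in> convex_cone hull (emb ` L)"
    and H: "H \<in> convex_cone hull {emb (- e)}" and sum: "emb e = F + G + H"
    unfolding convex_cone_hull_Un by auto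
  have "convex_cone {x. \<exists>c\<ge>0. x = c *\<^sub>R emb (- e)}"
    unfolding convex_cone_iff
  proof (intro conjI ballI allI impI)
    show "0 \<in> {x. \<exists>c\<ge>0. x = c *\<^sub>R emb (- e)}" by (auto intro!: exI[of _ 0])
  next
    fix x y assume "x \<in> {x. \<exists>c\<ge>0. x = c *\<^sub>R emb (- e)}" "y \<in> {x. \<exists>c\<ge>0. x = c *\<^sub>R emb (- e)}"
    then obtain c d where "0 \<le> c" "0 \<le> d" "x = c *\<^sub>R emb (- e)" "y = d *\<^sub>R emb (- e)" by blast
    then show "x + y \<in> {x. \<exists>c\<ge>0. x = c *\<^sub>R emb (- e)}"
      by (simp add: exI[of _ "c + d"] flip: scaleR_left_distrib)
  next
    fix x and d :: real assume "x \<in> {x. \<exists>c\<ge>0. x = c *\<^sub>R emb (- e)}" "0 \<le> d"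
    then obtain c where "0 \<le> c" "x = c *\<^sub>R emb (- e)" by blast
    then show "d *\<^sub>R x \<in> {x. \<exists>c\<ge>0. x = c *\<^sub>R emb (- e)}"
      using \<open>0 \<le> d\<close> by (auto intro!: exI[of _ "d * c"])
  qed
  moreover have "{emb (- e)} \<subseteq> {x. \<exists>c\<ge>0. x = c *\<^sub>R emb (- e)}"
    by (auto intro: exI[of _ 1])
  ultimately have "H \<in> {x. \<exists>c\<ge>0. x = c *\<^sub>R emb (- e)}"
    using H hull_minimal[of "{emb (- e)}" _ convex_cone] by blast
  moreover have "emb (- e) = - emb e" by (simp add: emb_def)
  ultimately obtain c where c: "0 \<le> c" "H = (- c) *\<^sub>R emb e" by auto
  have FG: "F + G = (1 + c) *\<^sub>R emb e"
    using sum c(2) by (simp add: algebra_simps)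
  have "det2_real F G \<le> 0"
  proof (rule det2_real_hull_nonpos[OF _ F G])
    fix f' g' assume "f' \<in> emb ` R" "g' \<in> emb ` L"
    then obtain f g where "f \<in> R" "g \<in> L" "f' = emb f" "g' = emb g" by blast
    then show "det2_real f' g' \<le> 0"
      using no unfolding R_def L_def by (simp add: det2_real_emb) (meson not_less)
  qed
  moreover have "det2_real F G = (1 + c) * det2_real F (emb e)"
    using arg_cong[OF FG, of "det2_real F"] by (simp add: det2_real_linear)
  moreover have "det2_real F G = (1 + c) * det2_real (emb e) G"
    using arg_cong[OF FG, of "\<lambda>x. det2_real x G"] by (simp add: det2_real_linear)
  ultimately have "det2_real F (emb e) \<le> 0" "det2_real (emb e) G \<le> 0"
    using c(1) by (auto simp: mult_le_0_iff)
  moreover have "F = 0 \<or> 0 < det2_real F (emb e)"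
    by (intro linear_pos_on_cone_hull[OF _ _ F] linearI)
      (auto simp: R_def det2_real_emb det2_real_linear)
  moreover have "G = 0 \<or> 0 < det2_real (emb e) G"
    by (intro linear_pos_on_cone_hull[OF _ _ G] linearI)
      (auto simp: L_def det2_real_emb det2_real_linear)
  ultimately have "(1 + c) *\<^sub>R emb e = 0" using FG by auto
  then have "emb e = 0" using c(1) by auto
  then show False using irr(1) by (auto simp: emb_def irreducible_vec_def zero_prod_def)
qed

section \<open>Vectors missing from a stencil\<close>

lemma stencil_familyD:
  assumes "stencil_family X V" "x \<in> X"
  shows "V x \<subseteq> V_max X x" "\<And>e f. e \<in> V x \<Longrightarrow> f \<in> V_max X x \<Longrightarrow> is_parent f e \<Longrightarrow> f \<in> V x"
    "Cone (V x) = Cone (V_max X x)"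
  using assms unfolding stencil_family_def by blast+

text \<open>Descent on \<open>det2 f g\<close>. While it is at least 2, a parent of the longer of the two vectors lies in
  the triangle \<open>0, f, g\<close>; it is admissible at \<open>x\<close> because \<open>X\<close> contains lattice triangles, and belongs to the stencil by
  stability. It splits the cone into two cones of smaller determinant, and \<open>e\<close> is strictly inside one of
  them because \<open>e\<close> itself is not in the stencil.\<close>

lemma enclosing_unimodular_pair:
  assumes V: "stencil_family X V" "x \<in> X" and X: "triangle_closed X"
    and e: "irreducible_vec e" "e \<notin> V x"
  shows "f \<in> V x \<Longrightarrow> g \<in> V x \<Longrightarrow> 0 < det2 f e \<Longrightarrow> 0 < det2 e g \<Longrightarrow> 0 < det2 f g \<Longrightarrow>
    \<exists>f\<in>V x. \<exists>g\<in>V x. det2 f g = 1 \<and> 0 < det2 f e \<and> 0 < det2 e g"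
proof (induction "nat (det2 f g)" arbitrary: f g rule: less_induct)
  case less
  note sD = stencil_familyD[OF V]
  have irr: "irreducible_vec h" "x + h \<in> X" if "h \<in> V x" for h
    using sD(1) that by (auto simp: V_max_def)
  show ?case
  proof (cases "det2 f g = 1")
    case True
    then show ?thesis using less.prems by blast
  next
    case False
    then have D: "2 \<le> det2 f g" using less.prems by simp
    have long: "1 < ip f f \<or> 1 < ip g g"
    proof (rule ccontr)
      assume "\<not> ?thesis"
      then have "ip f f * ip g g \<le> 1 * 1" by (intro mult_mono) (auto simp: ip_self_nonneg)
      moreover have "2^2 \<le> (det2 f g)^2" using D by (intro power_mono) auto
      ultimately show False using lagrange_identity[of f g] zero_le_power2[of "ip f g"] by simp
    qed
    have "\<exists>h\<in>V x. 0 < det2 f h \<and> 0 < det2 h g \<and> det2 f h < det2 f g \<and> det2 h g < det2 f g"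
    proof (cases "ip f f \<le> ip g g")
      case True
      then have "has_parents g" using long irr[OF less.prems(2)] by (auto simp: has_parents_iff)
      then obtain p q where dec: "direct_acute_decomp g p q" using direct_acute_decomp_exists by blast
      note in_cone = longer_left_parent_inside[OF irr(1)[OF less.prems(1)] D True dec]
      note dp = decomp_props[OF dec]
      have "x + p \<in> X"
        using in_cone dp(9) D less.prems
        by (intro triangle_closedD[OF X V(2) irr(2)[of f] irr(2)[of g]]) auto
      then have "p \<in> V x" using dp(3,5) less.prems(2) sD(2) by (auto simp: V_max_def)
      then show ?thesis using in_cone dp(9) D by (intro bexI[of _ p]) auto
    next
      case False
      then have "has_parents f" using long irr[OF less.prems(1)] by (auto simp: has_parents_iff)
      then obtain p q where dec: "direct_acute_decomp f p q" using direct_acute_decomp_exists by blast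
      have "ip g g \<le> ip f f" using False by simp
      note in_cone = longer_right_parent_inside[OF irr(1)[OF less.prems(2)] D this dec]
      note dp = decomp_props[OF dec]
      have "x + q \<in> X"
        using in_cone dp(10) D less.prems
        by (intro triangle_closedD[OF X V(2) irr(2)[of f] irr(2)[of g]]) auto
      then have "q \<in> V x" using dp(4,6) less.prems(1) sD(2) by (auto simp: V_max_def)
      then show ?thesis using in_cone dp(10) D by (intro bexI[of _ q]) auto
    qed
    then obtain h where h: "h \<in> V x" "0 < det2 f h" "0 < det2 h g" "det2 f h < det2 f g"
      "det2 h g < det2 f g" by blast
    have "det2 h e \<noteq> 0"
    proof
      assume "det2 h e = 0"
      then have "e = - h"
        using irreducible_parallel[OF irr(1)[OF h(1)] e(1)] h(1) e(2) by auto
      then show False using less.prems(3) h(2) by (simp add: det2_bilinear)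
    qed
    then consider "0 < det2 h e" | "0 < det2 e h" using det2_swap[of e h] by linarith
    then show ?thesis
    proof cases
      case 1
      then show ?thesis using less.hyps[of h g] h less.prems by simp
    next
      case 2
      then show ?thesis using less.hyps[of f h] h less.prems by simp
    qed
  qed
qed

text \<open>Descent on the coordinate sum of \<open>e\<close> in the basis. When the basis is obtuse, \<open>f + g\<close> is a parent
  of one of its members. It lies in one of the triangles \<open>0, e, g\<close> and \<open>0, f, e\<close>, so
  stability puts it into the stencil, and it may replace \<open>f\<close> or \<open>g\<close>.\<close>

lemma enclosing_acute_pair:
  assumes V: "stencil_family X V" "x \<in> X" and X: "triangle_closed X"
    and e: "e \<in> V_max X x" "e \<notin> V x"
  shows "f \<in> V x \<Longrightarrow> g \<in> V x \<Longrightarrow> det2 f g = 1 \<Longrightarrow> 0 < det2 f e \<Longrightarrow> 0 < det2 e g \<Longrightarrow>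
    \<exists>f\<in>V x. \<exists>g\<in>V x. det2 f g = 1 \<and> 0 \<le> ip f g \<and> 0 < det2 f e \<and> 0 < det2 e g"
proof (induction "nat (det2 f e + det2 e g)" arbitrary: f g rule: less_induct)
  case less
  note sD = stencil_familyD[OF V]
  have ie: "irreducible_vec e" "x + e \<in> X" using e by (auto simp: V_max_def)
  have inX: "x + h \<in> X" if "h \<in> V x" for h
    using sD(1) that by (auto simp: V_max_def)
  show ?case
  proof (cases "0 \<le> ip f g")
    case True
    then show ?thesis using less.prems by blast
  next
    case False
    define h where "h = f + g"
    have dh: "det2 f h = 1" "det2 h g = 1" "det2 h e = det2 f e - det2 e g"
      "det2 e h = det2 e g - det2 f e"
      using less.prems(3) by (auto simp: h_def det2_bilinear det2_swap[of e f] det2_swap[of g e])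
    have "x + h \<in> X"
    proof (cases "det2 f e \<le> det2 e g")
      case True
      then show ?thesis
        using dh less.prems ie
        by (intro triangle_closedD[OF X V(2) ie(2) inX[of g]]) auto
    next
      case False
      then show ?thesis
        using dh less.prems ie
        by (intro triangle_closedD[OF X V(2) inX[of f] ie(2)]) auto
    qed
    moreover have "irreducible_vec h" using irreducible_if_det1[of f h] dh by simp
    ultimately have "h \<in> V_max X x" by (simp add: V_max_def)
    then have hV: "h \<in> V x"
      using obtuse_sum_is_parent[of f g] less.prems False sD(2) unfolding h_def by (meson not_le)
    have "det2 h e \<noteq> 0"
    proof
      assume "det2 h e = 0"
      then have "e = - h"
        using irreducible_parallel[of h e] \<open>irreducible_vec h\<close> ie(1) hV e(2) by (auto simp: V_max_def)
      then show False using less.prems(4) dh(1) by (simp add: det2_bilinear)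
    qed
    then consider "0 < det2 h e" | "0 < det2 e h" using det2_swap[of e h] by linarith
    then show ?thesis
    proof cases
      case 1
      then show ?thesis using less.hyps[of h g] hV dh less.prems by simp
    next
      case 2
      then show ?thesis using less.hyps[of f h] hV dh less.prems by simp
    qed
  qed
qed

text \<open>The key structural fact: a vector which is admissible at \<open>x\<close> but absent from the stencil has both
  parents admissible. Let \<open>(f, g)\<close> be an acute unimodular pair from the stencil with \<open>e\<close> strictly
  inside its cone, so that \<open>e\<close> is longer than \<open>f\<close> and \<open>g\<close>. If \<open>f\<close> were strictly between \<open>p\<close> and \<open>e\<close>,
  it would be longer than \<open>e\<close>; hence the parents of \<open>e\<close> lie in the cone of \<open>f\<close> and \<open>g\<close>, and more precisely in
  the triangles \<open>0, f, e\<close> and \<open>0, e, g\<close>.\<close>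

lemma missing_vector_parents:
  assumes V: "stencil_family X V" "x \<in> X" and X: "triangle_closed X"
    and e: "e \<in> V_max X x" "e \<notin> V x"
  obtains p q where "direct_acute_decomp e p q" "p \<in> V_max X x" "q \<in> V_max X x"
proof -
  note sD = stencil_familyD[OF V]
  have ie: "irreducible_vec e" "x + e \<in> X" using e by (auto simp: V_max_def)
  have "emb e \<in> Cone (V x)"
    unfolding sD(3) unfolding Cone_def using e(1) by (intro hull_inc) auto
  moreover have "irreducible_vec f" if "f \<in> V x" for f using sD(1) that by (auto simp: V_max_def)
  ultimately obtain f g
    where "f \<in> V x" "g \<in> V x" "0 < det2 f e" "0 < det2 e g" "0 < det2 f g"
    using cone_member_strictly_between[OF ie(1), of "V x"] e(2) by blast
  then obtain f g where "f \<in> V x" "g \<in> V x" "det2 f g = 1" "0 < det2 f e" "0 < det2 e g"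
    using enclosing_unimodular_pair[OF V X ie(1) e(2)] by blast
  then obtain f g where fg: "f \<in> V x" "g \<in> V x" "det2 f g = 1" "0 \<le> ip f g"
    "0 < det2 f e" "0 < det2 e g"
    using enclosing_acute_pair[OF V X e] by blast
  then have inX: "x + f \<in> X" "x + g \<in> X" using sD(1) by (auto simp: V_max_def)
  note shorter = inside_acute_cone_longer[OF fg(3-6)]
  have "0 < ip f f" using ip_self_pos[of f g] fg(3) by simp
  then have "has_parents e" using ie(1) shorter by (simp add: has_parents_iff)
  then obtain p q where dec: "direct_acute_decomp e p q" using direct_acute_decomp_exists by blast
  note dp = decomp_props[OF dec]
  have sum: "e = p + q" and pq: "det2 p q = 1" "0 \<le> ip p q"
    using dec by (auto simp: direct_acute_decomp_iff)
  have fp: "0 \<le> det2 f p"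
  proof (rule ccontr)
    assume "\<not> ?thesis"
    then have "0 < det2 p f" by (simp add: det2_swap[of p f])
    moreover have "0 \<le> ip p e" using pq by (simp add: sum ip_bilinear ip_self_nonneg)
    ultimately show False
      using inside_acute_cone_longer(2)[of p e f] dp(9) fg(5) shorter by simp
  qed
  have qg: "0 \<le> det2 q g"
  proof (rule ccontr)
    assume "\<not> ?thesis"
    then have "0 < det2 g q" by (simp add: det2_swap[of g q])
    moreover have "0 \<le> ip e q" using pq by (simp add: sum ip_bilinear ip_self_nonneg)
    ultimately show False
      using inside_acute_cone_longer(1)[of e q g] dp(10) fg(6) shorter by simp
  qed
  have split: "det2 f e = det2 f p + det2 f q" "det2 e g = det2 p g + det2 q g"
    by (simp_all add: sum det2_bilinear)
  \<comment> \<open>Seen from \<open>f\<close>, the vector \<open>q\<close> lies beyond \<open>e\<close>, hence not on the ray of \<open>f\<close>; symmetrically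
    \<open>p\<close> is not on the ray of \<open>g\<close>.\<close>
  have pos: "0 < det2 f q" "0 < det2 p g"
  proof -
    have "det2 e g * det2 f q = det2 f g * det2 e q + det2 f e * det2 q g"
      by (simp add: det2_def algebra_simps)
    moreover have "0 \<le> det2 f e * det2 q g" using fg(5) qg by simp
    ultimately have "0 < det2 e g * det2 f q" using fg(3) dp(10) by simp
    then show "0 < det2 f q" using fg(6) by (simp add: zero_less_mult_iff)
    have "det2 f e * det2 p g = det2 f g * det2 p e + det2 e g * det2 f p"
      by (simp add: det2_def algebra_simps)
    moreover have "0 \<le> det2 e g * det2 f p" using fg(6) fp by simp
    ultimately have "0 < det2 f e * det2 p g" using fg(3) dp(9) by simp
    then show "0 < det2 p g" using fg(5) by (simp add: zero_less_mult_iff)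
  qed
  \<comment> \<open>Hence \<open>p\<close> lies in the triangle \<open>0, f, e\<close>, and \<open>q\<close> in the triangle \<open>0, e, g\<close>.\<close>
  have "x + p \<in> X"
    using fp pos fg dp(9) split by (intro triangle_closedD[OF X V(2) inX(1) ie(2)]) auto
  moreover have "x + q \<in> X"
    using qg pos fg dp(10) split by (intro triangle_closedD[OF X V(2) ie(2) inX(2)]) auto
  ultimately show ?thesis using that[OF dec] dp(5,6) by (auto simp: V_max_def)
qed

section \<open>Unions and intersections of families\<close>

lemma Cone_add:
  assumes "emb f \<in> Cone A" "emb g \<in> Cone A"
  shows "emb (f + g) \<in> Cone A"
proof -
  have "emb (f + g) = emb f + emb g" by (simp add: emb_def)
  then show ?thesis using assms unfolding Cone_def by (simp add: convex_cone_hull_add)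
qed

lemma Cone_mono: "A \<subseteq> B \<Longrightarrow> Cone A \<subseteq> Cone B"
  unfolding Cone_def by (intro hull_mono image_mono)

lemma stencil_family_Un:
  assumes V: "stencil_family X V" and V': "stencil_family X V'"
  shows "stencil_family X (\<lambda>x. V x \<union> V' x)"
  unfolding stencil_family_def
proof (intro ballI conjI)
  fix x assume x: "x \<in> X"
  note D = stencil_familyD[OF V x] and D' = stencil_familyD[OF V' x]
  show sub: "V x \<union> V' x \<subseteq> V_max X x" using D(1) D'(1) by blast
  show "is_parent f e \<longrightarrow> f \<in> V x \<union> V' x" if "e \<in> V x \<union> V' x" "f \<in> V_max X x" for e f
    using that D(2) D'(2) by blast
  show "Cone (V x \<union> V' x) = Cone (V_max X x)"
    using Cone_mono[of "V x" "V x \<union> V' x"] Cone_mono[OF sub] D(3) by blast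
qed

text \<open>For visibility, each admissible \<open>e\<close> outside the intersection is missing from one of the two
  stencils, hence is the sum of two shorter admissible vectors. By induction on the norm it is in the cone
  of the intersection.\<close>

lemma stencil_family_Int:
  assumes X: "triangle_closed X"
    and V: "stencil_family X V" and V': "stencil_family X V'"
  shows "stencil_family X (\<lambda>x. V x \<inter> V' x)"
  unfolding stencil_family_def
proof (intro ballI conjI)
  fix x assume x: "x \<in> X"
  note D = stencil_familyD[OF V x] and D' = stencil_familyD[OF V' x]
  show sub: "V x \<inter> V' x \<subseteq> V_max X x" using D(1) D'(1) by blast
  show "is_parent f e \<longrightarrow> f \<in> V x \<inter> V' x" if "e \<in> V x \<inter> V' x" "f \<in> V_max X x" for e f
    using that D(2) D'(2) by blast
  have "e \<in> V_max X x \<Longrightarrow> emb e \<in> Cone (V x \<inter> V' x)" for e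
  proof (induction "nat (ip e e)" arbitrary: e rule: less_induct)
    case less
    show ?case
    proof (cases "e \<in> V x \<inter> V' x")
      case True
      then show ?thesis unfolding Cone_def by (intro hull_inc) auto
    next
      case False
      then obtain p q where dec: "direct_acute_decomp e p q" "p \<in> V_max X x" "q \<in> V_max X x"
        using missing_vector_parents[OF V x X less.prems] missing_vector_parents[OF V' x X less.prems]
        by blast
      note dp = decomp_props[OF dec(1)]
      have "nat (ip p p) < nat (ip e e)" "nat (ip q q) < nat (ip e e)"
        using dp(7,8) ip_self_nonneg[of p] ip_self_nonneg[of q] by auto
      then have "emb (p + q) \<in> Cone (V x \<inter> V' x)"
        using less.hyps dec by (intro Cone_add) auto
      then show ?thesis using dec(1) by (simp add: direct_acute_decomp_iff)
    qed
  qed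
  then have "Cone (V_max X x) \<subseteq> Cone (V x \<inter> V' x)"
    unfolding Cone_def[of "V_max X x"]
    by (intro hull_minimal) (auto simp: Cone_def convex_cone_convex_cone_hull)
  then show "Cone (V x \<inter> V' x) = Cone (V_max X x)" using Cone_mono[OF sub] by blast
qed

section \<open>Nonnegative forms on the cone of a family\<close>

lemma P_form_eq:
  "direct_acute_decomp e p q \<Longrightarrow> P_form x e u = u (x + e) - u (x + p) - u (x + q) + u x"
  by (simp add: P_form_def decomp_props(2))

lemma T_form_eq:
  "direct_acute_decomp e p q \<Longrightarrow> T_form x e u = P_form x e u + S_form x p u + S_form x q u"
  by (simp add: P_form_def T_form_def S_form_def decomp_props(2))

lemma S_form_uminus: "S_form x (- e) u = S_form x e u"
  by (simp add: S_form_def)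

lemma S_form_eq:
  "direct_acute_decomp e p q \<Longrightarrow>
     S_form x e u = P_form x e u + P_form x (- e) u + S_form x p u + S_form x q u"
  by (simp add: P_form_eq[of e p q] P_form_eq[OF decomp_uminus] S_form_def)

text \<open>The acute basis of the parents of \<open>e\<close> shares one vector with the acute basis of the parents of
  the longer parent. This lets \<open>P_form\<close> at \<open>e\<close> be traded for \<open>P_form\<close> at that parent and a second
  difference along the other one, at a shifted point.\<close>

lemma P_form_eq_fst_parent:
  assumes "direct_acute_decomp e p q" "direct_acute_decomp q p r"
  shows "P_form x e u = P_form x q u + S_form (x + q) p u"
proof -
  have "x + e = x + q + p" "x + r = x + q - p"
    using assms by (auto simp: direct_acute_decomp_iff algebra_simps)
  then show ?thesis
    by (simp only: P_form_eq[OF assms(1)] P_form_eq[OF assms(2)] S_form_def)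
qed

lemma P_form_eq_snd_parent:
  assumes "direct_acute_decomp e p q" "direct_acute_decomp p r q"
  shows "P_form x e u = P_form x p u + S_form (x + p) q u"
proof -
  have "x + e = x + p + q" "x + r = x + p - q"
    using assms by (auto simp: direct_acute_decomp_iff algebra_simps)
  then show ?thesis
    by (simp only: P_form_eq[OF assms(1)] P_form_eq[OF assms(2)] S_form_def)
qed

lemma acute_basis_reduce_snd:
  assumes "direct_acute_decomp e p q" "ip p p \<le> ip q q" "1 < ip q q"
  shows "direct_acute_decomp q p (q - p)"
  using assms basis_reduction[of p q]
  by (simp add: direct_acute_decomp_iff det2_bilinear ip_bilinear)

lemma acute_basis_reduce_fst:
  assumes "direct_acute_decomp e p q" "ip q q \<le> ip p p" "1 < ip p p"
  shows "direct_acute_decomp p (p - q) q"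
  using assms basis_reduction[of q p]
  by (simp add: direct_acute_decomp_iff det2_bilinear ip_bilinear det2_swap[of q p] ip_commute[of q p])

lemma ConvD:
  assumes "u \<in> Conv X W" "x \<in> X"
  shows "e \<in> W x \<Longrightarrow> irreducible_vec e \<Longrightarrow> x + e \<in> X \<Longrightarrow> x - e \<in> X \<Longrightarrow> 0 \<le> S_form x e u"
    "e \<in> W x \<Longrightarrow> norm (emb e) > 1 \<Longrightarrow> form_support (T_form x e) \<subseteq> X \<Longrightarrow> 0 \<le> T_form x e u"
    "e \<in> candidates X W x \<Longrightarrow> 0 \<le> P_form x e u"
  using assms unfolding Conv_def by (auto simp: form_support_S)

text \<open>If both parents of \<open>e\<close> are in the stencil, then \<open>e\<close> is a candidate. Otherwise the longer
  parent, say \<open>q\<close>, is missing: if it were present, stability would supply \<open>p\<close> too, as \<open>p\<close> is a parent of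
  \<open>q\<close>. So \<open>q\<close> has admissible parents \<open>p\<close> and \<open>q - p\<close>, and the induction hypothesis applies to
  both terms of \<open>P\<^sub>y\<^sup>e = P\<^sub>y\<^sup>q + S\<^sub>z\<^sup>p\<close> with \<open>z = y + q\<close>: the neighbours of \<open>z\<close> along \<open>p\<close> are \<open>y + e\<close>
  and \<open>y + (q - p)\<close>. The second difference is needed at \<open>z\<close>, where nothing is known about the stencil; this
  is why the induction runs over all points of \<open>X\<close> and treats both kinds of form together. Unit vectors have no parents,
  hence are never missing.\<close>

lemma P_form_nonneg_step:
  assumes X: "triangle_closed X" and W: "stencil_family X W" and u: "u \<in> Conv X W"
    and IH: "\<And>y e'. nat (ip e' e') < nat (ip e e) \<Longrightarrow> y \<in> X \<Longrightarrow>
      (e' \<in> V_max X y - W y \<longrightarrow> 0 \<le> P_form y e' u) \<and>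
      (irreducible_vec e' \<longrightarrow> y + e' \<in> X \<longrightarrow> y - e' \<in> X \<longrightarrow> 0 \<le> S_form y e' u)"
    and y: "y \<in> X" and e: "e \<in> V_max X y - W y"
  shows "0 \<le> P_form y e u"
proof -
  note sD = stencil_familyD[OF W y]
  obtain p q where dec: "direct_acute_decomp e p q" and pq: "p \<in> V_max X y" "q \<in> V_max X y"
    using missing_vector_parents[OF W y X, of e] e by blast
  note dp = decomp_props[OF dec]
  have small: "nat (ip p p) < nat (ip e e)" "nat (ip q q) < nat (ip e e)"
    using dp(7,8) ip_self_nonneg[of p] ip_self_nonneg[of q] by auto
  have long: "1 < ip h h" if h: "h \<in> V_max X y" "h \<notin> W y" for h
  proof -
    obtain r s where "direct_acute_decomp h r s" using missing_vector_parents[OF W y X h] by blast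
    then show ?thesis using decomp_props(1) by (simp add: has_parents_iff)
  qed
  have inX: "y + h \<in> X" if "h \<in> V_max X y" for h using that by (simp add: V_max_def)
  have split: "h \<in> V_max X y \<Longrightarrow> h \<notin> W y \<Longrightarrow> direct_acute_decomp h r s \<Longrightarrow>
      r \<in> V_max X y \<and> s \<in> V_max X y" for h r s
    using missing_vector_parents[OF W y X, of h] direct_acute_decomp_unique by metis
  show ?thesis
  proof (cases "p \<in> W y \<and> q \<in> W y")
    case True
    then have "e \<in> candidates X W y" using e dp(1,2) by (simp add: candidates_def)
    then show ?thesis using ConvD(3)[OF u y] by blast
  next
    case False
    show ?thesis
    proof (cases "ip p p \<le> ip q q")
      case True
      have "1 < ip q q" using True False long pq by fastforce
      note red = acute_basis_reduce_snd[OF dec True this]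
      have q: "q \<notin> W y" using False sD(2)[of q p] pq decomp_props(3)[OF red] by blast
      have "y + (q - p) \<in> X" using split[OF pq(2) q red] inX by blast
      then have "0 \<le> S_form (y + q) p u"
        using IH[OF small(1), of "y + q"] inX[OF pq(2)] inX[of e] e dp(5) dec
        by (auto simp: direct_acute_decomp_iff algebra_simps)
      moreover have "0 \<le> P_form y q u" using IH[OF small(2) y] pq q by blast
      ultimately show ?thesis by (simp add: P_form_eq_fst_parent[OF dec red])
    next
      case le: False
      then have le: "ip q q \<le> ip p p" by simp
      have "1 < ip p p" using le False long pq by fastforce
      note red = acute_basis_reduce_fst[OF dec le this]
      have p: "p \<notin> W y" using False sD(2)[of p q] pq decomp_props(4)[OF red] by blast
      have "y + (p - q) \<in> X" using split[OF pq(1) p red] inX by blast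
      then have "0 \<le> S_form (y + p) q u"
        using IH[OF small(2), of "y + p"] inX[OF pq(1)] inX[of e] e dp(6) dec
        by (auto simp: direct_acute_decomp_iff algebra_simps)
      moreover have "0 \<le> P_form y p u" using IH[OF small(1) y] pq p by blast
      ultimately show ?thesis by (simp add: P_form_eq_snd_parent[OF dec red])
    qed
  qed
qed

text \<open>The constraints that define \<open>Conv X W\<close> imply many more: all second differences that fit into \<open>X\<close>, and
  \<open>P_form\<close> at all admissible vectors missing from the stencil. By symmetry a second difference is already
  constrained when \<open>e\<close> or \<open>- e\<close> is in the stencil. If neither is, then \<open>\<plusminus> p\<close> and
  \<open>\<plusminus> q\<close> are admissible and \<open>S\<^sup>e = P\<^sup>e + P\<^sup>-\<^sup>e + S\<^sup>p + S\<^sup>q\<close>, where the terms \<open>P\<close> are of the same norm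
  as \<open>e\<close> and covered by the previous lemma.\<close>

lemma Conv_forms_nonneg:
  assumes X: "triangle_closed X" and W: "stencil_family X W" and u: "u \<in> Conv X W"
  shows "y \<in> X \<Longrightarrow> (e \<in> V_max X y - W y \<longrightarrow> 0 \<le> P_form y e u) \<and>
      (irreducible_vec e \<longrightarrow> y + e \<in> X \<longrightarrow> y - e \<in> X \<longrightarrow> 0 \<le> S_form y e u)"
proof (induction "nat (ip e e)" arbitrary: e y rule: less_induct)
  case less
  have IH: "(e'' \<in> V_max X z - W z \<longrightarrow> 0 \<le> P_form z e'' u) \<and>
      (irreducible_vec e'' \<longrightarrow> z + e'' \<in> X \<longrightarrow> z - e'' \<in> X \<longrightarrow> 0 \<le> S_form z e'' u)"
    if "nat (ip e'' e'') < nat (ip e' e')" "z \<in> X" "ip e' e' = ip e e" for e' e'' z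
    using less.hyps[of e'' z] that by simp
  have P: "0 \<le> P_form y e' u" if "ip e' e' = ip e e" "e' \<in> V_max X y - W y" for e'
    by (rule P_form_nonneg_step[OF X W u IH[OF _ _ that(1)] less.prems that(2)])
  show ?case
  proof (intro conjI impI)
    assume "e \<in> V_max X y - W y"
    then show "0 \<le> P_form y e u" using P by blast
  next
    assume e: "irreducible_vec e" "y + e \<in> X" "y - e \<in> X"
    then have Vm: "e \<in> V_max X y" "- e \<in> V_max X y" by (auto simp: V_max_def)
    show "0 \<le> S_form y e u"
    proof (cases "e \<in> W y \<or> - e \<in> W y")
      case True
      then show ?thesis
        using ConvD(1)[OF u less.prems, of e] ConvD(1)[OF u less.prems, of "- e"] e
        by (auto simp: S_form_uminus)
    next
      case False
      obtain p q where dec: "direct_acute_decomp e p q" "p \<in> V_max X y" "q \<in> V_max X y"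
        using missing_vector_parents[OF W less.prems X, of e] Vm False by blast
      obtain p' q' where dec': "direct_acute_decomp (- e) p' q'" "p' \<in> V_max X y" "q' \<in> V_max X y"
        using missing_vector_parents[OF W less.prems X, of "- e"] Vm False by blast
      then have "p' = - p" "q' = - q"
        using direct_acute_decomp_unique[OF dec'(1) decomp_uminus[OF dec(1)]] by auto
      then have inX: "y + p \<in> X" "y - p \<in> X" "y + q \<in> X" "y - q \<in> X"
        using dec(2,3) dec'(2,3) by (auto simp: V_max_def)
      note dp = decomp_props[OF dec(1)]
      have "nat (ip p p) < nat (ip e e)" "nat (ip q q) < nat (ip e e)"
        using dp(7,8) ip_self_nonneg[of p] ip_self_nonneg[of q] by auto
      then have "0 \<le> S_form y p u" "0 \<le> S_form y q u"
        using less.hyps[of p y] less.hyps[of q y] less.prems inX dp(5,6) by auto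
      moreover have "0 \<le> P_form y e u" "0 \<le> P_form y (- e) u"
        using P[of e] P[of "- e"] Vm False by (auto simp: ip_bilinear)
      ultimately show ?thesis by (simp add: S_form_eq[OF dec(1)])
    qed
  qed
qed

section \<open>Monotonicity and the lattice structure\<close>

text \<open>A larger stencil replaces some constraints \<open>P_form\<close> by constraints \<open>S_form\<close>, \<open>T_form\<close> and
  further \<open>P_form\<close>, all of which already follow from the smaller one; for the new \<open>T_form\<close> this is the
  identity \<open>T\<^sup>e = P\<^sup>e + S\<^sup>p + S\<^sup>q\<close>.\<close>

lemma Conv_mono:
  assumes X: "triangle_closed X" and W: "stencil_family X W" and V: "stencil_family X V"
    and sub: "\<And>x. x \<in> X \<Longrightarrow> W x \<subseteq> V x"
  shows "Conv X W \<subseteq> Conv X V"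
proof
  fix u assume u: "u \<in> Conv X W"
  note nonneg = Conv_forms_nonneg[OF X W u]
  have "0 \<le> S_form x e u" if "x \<in> X" "e \<in> V x" "form_support (S_form x e) \<subseteq> X" for x e
    using nonneg[of x e] stencil_familyD(1)[OF V that(1)] that
    by (auto simp: form_support_S V_max_def)
  moreover have "0 \<le> T_form x e u"
    if x: "x \<in> X" and e: "e \<in> V x" "norm (emb e) > 1" and T: "form_support (T_form x e) \<subseteq> X" for x e
  proof (cases "e \<in> W x")
    case True
    then show ?thesis using ConvD(2)[OF u x] e(2) T by blast
  next
    case False
    have eV: "e \<in> V_max X x" using stencil_familyD(1)[OF V x] e by blast
    then obtain p q where dec: "direct_acute_decomp e p q" "p \<in> V_max X x" "q \<in> V_max X x"
      using missing_vector_parents[OF W x X _ False] by blast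
    note dp = decomp_props[OF dec(1)]
    have "x - p \<in> X" "x - q \<in> X" using T by (auto simp: form_support_T[OF dp(1)] dp(2))
    then have "0 \<le> S_form x p u" "0 \<le> S_form x q u"
      using nonneg[OF x] dec(2,3) by (auto simp: V_max_def)
    moreover have "0 \<le> P_form x e u" using nonneg[OF x] eV False by blast
    ultimately show ?thesis by (simp add: T_form_eq[OF dec(1)])
  qed
  moreover have "0 \<le> P_form x e u" if "x \<in> X" "e \<in> candidates X V x" for x e
    using nonneg[OF that(1), of e] that sub[OF that(1)] unfolding candidates_def by blast
  moreover have "u \<in> extensional X" using u by (simp add: Conv_def)
  ultimately show "u \<in> Conv X V" by (simp add: Conv_def)
qed

text \<open>A candidate of the intersection is missing from one of the stencils while its parents are in
  both, so it is a candidate of that stencil.\<close>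

lemma Conv_Int_subset: "Conv X V \<inter> Conv X V' \<subseteq> Conv X (\<lambda>x. V x \<inter> V' x)"
proof
  fix u assume "u \<in> Conv X V \<inter> Conv X V'"
  moreover have "candidates X (\<lambda>x. V x \<inter> V' x) x \<subseteq> candidates X V x \<union> candidates X V' x" for x
    by (auto simp: candidates_def)
  ultimately show "u \<in> Conv X (\<lambda>x. V x \<inter> V' x)" unfolding Conv_def by blast
qed

theorem theorem1p8:
  fixes \<Omega> :: "(real \<times> real) set"
    and X :: "point set"
    and V V' :: "point \<Rightarrow> point set"
  assumes "compact \<Omega>" and "convex \<Omega>"
    and "X = lattice_points \<Omega>"
    and "stencil_family X V" and "stencil_family X V'"
  shows "stencil_family X (\<lambda>x. V x \<union> V' x)
    \<and> stencil_family X (\<lambda>x. V x \<inter> V' x)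
    \<and> Conv X V \<inter> Conv X V' = Conv X (\<lambda>x. V x \<inter> V' x)
    \<and> Conv X V \<union> Conv X V' \<subseteq> Conv X (\<lambda>x. V x \<union> V' x)"
proof -
  have X: "triangle_closed X" using triangle_closed_lattice_points assms(2,3) by simp
  note V = assms(4) and V' = assms(5)
  note union = stencil_family_Un[OF V V'] and inter = stencil_family_Int[OF X V V']
  have "Conv X (\<lambda>x. V x \<inter> V' x) \<subseteq> Conv X V \<inter> Conv X V'"
    using Conv_mono[OF X inter V] Conv_mono[OF X inter V'] by blast
  moreover have "Conv X V \<union> Conv X V' \<subseteq> Conv X (\<lambda>x. V x \<union> V' x)"
    using Conv_mono[OF X V union] Conv_mono[OF X V' union] by blast
  ultimately show ?thesis using union inter Conv_Int_subset by blast
qed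

end
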